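(* Let $X$ be an arbitrary bounded metric space, let $\lambda>0$ be a real number, and let $\lambda\Delta$ be a simplex all of whose non-zero distances equal $\lambda$, of (finite or infinite) cardinality $\#\lambda\Delta$ with $\#X<\#\lambda\Delta$. Then $$2d_{GH}(\lambda\Delta,X)=\max\{\lambda,\ \operatorname{diam}X-\lambda\}.$$
   Context: Metric spaces are assumed non-empty. $\#X$ denotes the cardinality of the set $X$. A simplex is a metric space all of whose non-zero distances are equal to each other; for a real $\lambda>0$, $\lambda\Delta$ denotes a simplex whose non-zero distances all equal $\lambda$ (its cardinality may be any finite or infinite non-zero cardinal). For metric spaces $X,Y$, the Gromov--Hausdorff distance $d_{GH}(X,Y)$ is the infimum of real numbers $r$ for which there exist a metric space $Z$ and subsets $X',Y'\subset Z$ isometric to $X$ and $Y$, respectively, such that $d_H(X',Y')\le r$, where $d_H$ is the Hausdorff distance in $Z$: $d_H(A,B)=\max\{\sup_{a\in A}\inf_{b\in B}|ab|,\ \sup_{b\in B}\inf_{a\in A}|ab|\}$ and $|ab|$ is the distance between points $a$ and $b$. *)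

theory Defs
  imports "HOL-Analysis.Analysis"
begin

text \<open>Suprema, infima and the resulting distances are taken in \<^typ>\<open>ereal\<close>, so that they are
  meaningful for unbounded sets as well. Non-emptiness of spaces is not built into
  \<^typ>\<open>'a metric\<close>; it has to be assumed separately.\<close>

definition isometric_spaces :: "'a metric \<Rightarrow> 'b metric \<Rightarrow> bool" where
  "isometric_spaces X Y \<longleftrightarrow>
     (\<exists>f. bij_betw f (mspace X) (mspace Y) \<and>
          (\<forall>x\<in>mspace X. \<forall>x'\<in>mspace X. mdist Y (f x) (f x') = mdist X x x'))"

definition hausdorff_dist :: "'a metric \<Rightarrow> 'a set \<Rightarrow> 'a set \<Rightarrow> ereal" where
  "hausdorff_dist Z A B =
     max (SUP a\<in>A. INF b\<in>B. ereal (mdist Z a b)) (SUP b\<in>B. INF a\<in>A. ereal (mdist Z a b))"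

definition gh_realizable :: "'a metric \<Rightarrow> 'b metric \<Rightarrow> 'c metric \<Rightarrow> real \<Rightarrow> bool" where
  "gh_realizable X Y Z r \<longleftrightarrow>
     (\<exists>A B. A \<subseteq> mspace Z \<and> B \<subseteq> mspace Z \<and>
            isometric_spaces (submetric Z A) X \<and> isometric_spaces (submetric Z B) Y \<and>
            hausdorff_dist Z A B \<le> ereal r)"

text \<open>The ambient space ranges over all metric spaces whose points lie in the type
  \<^typ>\<open>'a + 'b\<close>. This is no restriction: only the points of the two copies of \<open>X\<close> and \<open>Y\<close>
  matter, and their union always embeds into \<^typ>\<open>'a + 'b\<close>; see \<open>gh_realizable_sum_type\<close>
  and \<open>gh_dist_le\<close> below.\<close>

definition gh_dist :: "'a metric \<Rightarrow> 'b metric \<Rightarrow> ereal" where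
  "gh_dist X Y = Inf {ereal r |r. \<exists>Z :: ('a + 'b) metric. gh_realizable X Y Z r}"

definition space_diam :: "'a metric \<Rightarrow> ereal" where
  "space_diam X = (SUP x\<in>mspace X. SUP y\<in>mspace X. ereal (mdist X x y))"

definition is_simplex :: "real \<Rightarrow> 'a metric \<Rightarrow> bool" where
  "is_simplex l S \<longleftrightarrow> mspace S \<noteq> {} \<and>
     (\<forall>x\<in>mspace S. \<forall>y\<in>mspace S. mdist S x y \<noteq> 0 \<longrightarrow> mdist S x y = l)"

lemma gh_realizable_sum_type:
  fixes X :: "'a metric" and Y :: "'b metric" and Z :: "'c metric"
  assumes "gh_realizable X Y Z r"
  shows "\<exists>Z' :: ('a + 'b) metric. gh_realizable X Y Z' r"
proof -
  obtain A B f h where AB: "A \<subseteq> mspace Z" "B \<subseteq> mspace Z"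
    and f: "bij_betw f A (mspace X)" "\<And>x x'. x\<in>A \<Longrightarrow> x'\<in>A \<Longrightarrow> mdist X (f x) (f x') = mdist Z x x'"
    and h: "bij_betw h B (mspace Y)" "\<And>x x'. x\<in>B \<Longrightarrow> x'\<in>B \<Longrightarrow> mdist Y (h x) (h x') = mdist Z x x'"
    and H: "hausdorff_dist Z A B \<le> ereal r"
    using assms unfolding gh_realizable_def isometric_spaces_def
    by (auto simp: Int_absorb2 Int_absorb1)
  define g :: "'c \<Rightarrow> 'a + 'b" where "g = (\<lambda>z. if z \<in> A then Inl (f z) else Inr (h z))"
  have inj: "inj_on g (A \<union> B)"
    using bij_betw_imp_inj_on[OF f(1)] bij_betw_imp_inj_on[OF h(1)]
    by (auto simp: inj_on_def g_def)
  define k where "k = inv_into (A \<union> B) g"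
  have kg: "k (g z) = z" if "z \<in> A \<union> B" for z
    using that inj by (simp add: k_def)
  define Z' where "Z' = metric (g ` (A \<union> B), \<lambda>u v. mdist Z (k u) (k v))"
  interpret Z': Metric_space "g ` (A \<union> B)" "\<lambda>u v. mdist Z (k u) (k v)"
    by unfold_locales (use AB kg in \<open>auto simp: mdist_commute subset_iff intro!: mdist_triangle\<close>)
  have Z'm: "mspace Z' = g ` (A \<union> B)" and Z'd: "mdist Z' = (\<lambda>u v. mdist Z (k u) (k v))"
    by (simp_all add: Z'_def)
  have bij: "bij_betw k (g ` C) C" if "C \<subseteq> A \<union> B" for C
    using that kg by (intro bij_betw_byWitness[where f' = g]) auto
  have iso: "isometric_spaces (submetric Z' (g ` C)) W"
    if C: "C \<subseteq> A \<union> B" and p: "bij_betw p C (mspace W)"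
      and q: "\<And>x x'. x\<in>C \<Longrightarrow> x'\<in>C \<Longrightarrow> mdist W (p x) (p x') = mdist Z x x'"
    for C and W :: "'d metric" and p
    unfolding isometric_spaces_def
  proof (intro exI[of _ "p \<circ> k"] conjI)
    have "mspace (submetric Z' (g ` C)) = g ` C"
      using C by (auto simp: Z'm)
    then show "bij_betw (p \<circ> k) (mspace (submetric Z' (g ` C))) (mspace W)"
      using bij_betw_trans[OF bij[OF C] p] by simp
    show "\<forall>x\<in>mspace (submetric Z' (g ` C)). \<forall>x'\<in>mspace (submetric Z' (g ` C)).
            mdist W ((p \<circ> k) x) ((p \<circ> k) x') = mdist (submetric Z' (g ` C)) x x'"
      using C kg q by (auto simp: Z'd subset_iff)
  qed
  have "hausdorff_dist Z' (g ` A) (g ` B) = hausdorff_dist Z A B"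
    unfolding hausdorff_dist_def Z'd image_image
    by (intro arg_cong2[where f = max] SUP_cong INF_cong refl) (simp_all add: kg)
  with iso[OF _ f] iso[OF _ h] H have "gh_realizable X Y Z' r"
    unfolding gh_realizable_def by (intro exI[of _ "g ` A"] exI[of _ "g ` B"]) (auto simp: Z'm)
  then show ?thesis ..
qed

lemma gh_dist_le: "gh_realizable X Y Z r \<Longrightarrow> gh_dist X Y \<le> ereal r"
  unfolding gh_dist_def by (rule Inf_lower) (use gh_realizable_sum_type in blast)

end

theory Submission
  imports Defs
begin

text \<open>Let \<open>r\<close> be half of the right-hand side.

  Lower bound: suppose that copies of \<open>S\<close> and \<open>X\<close> lie within Hausdorff distance \<open>t\<close> of each
  other. Every point of the copy of \<open>S\<close> is almost \<open>t\<close>-close to some point of the copy of \<open>X\<close>.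
  As \<open>X\<close> has fewer points than \<open>S\<close>, two distinct points of the simplex must share such a
  neighbour, so \<open>l \<le> 2 * t\<close>. On the other hand, any two points of \<open>X\<close> are almost \<open>t\<close>-close to
  points of the simplex, which are at most \<open>l\<close> apart, so \<open>diam X \<le> l + 2 * t\<close>.

  Upper bound: since \<open>X\<close> has no more points than \<open>S\<close>, there is a map \<open>f\<close> from \<open>S\<close> onto \<open>X\<close>.
  Glue the two spaces by putting each \<open>s\<close> at distance \<open>r\<close> from \<open>f s\<close> and
  taking shortest paths; because any two points of \<open>S\<close> are at most \<open>l\<close> apart and \<open>f\<close> is onto,
  the distance from \<open>s\<close> to \<open>x\<close> becomes \<open>r + min l (mdist X (f s) x)\<close>.
  The inequalities \<open>l \<le> 2 * r\<close> and \<open>diam X - l \<le> 2 * r\<close> guarantee that the gluing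
  shortens no distance inside \<open>S\<close> or \<open>X\<close>, so the two copies are isometric to the originals and
  lie within Hausdorff distance \<open>r\<close>. The lemmas \<open>gh_realizable_simplex_lower_bound\<close> and
  \<open>gh_realizable_simplex\<close> carry the two halves.\<close>

section \<open>Hausdorff distance and diameter\<close>

lemma hausdorff_dist_commute: "hausdorff_dist Z A B = hausdorff_dist Z B A"
  by (simp add: hausdorff_dist_def mdist_commute max.commute)

text \<open>The infimum over \<open>B\<close> need not be attained, hence the slack \<open>e\<close>.\<close>

lemma hausdorff_dist_leD:
  assumes "hausdorff_dist Z A B \<le> ereal r" "a \<in> A" "e > 0"
  shows "\<exists>b\<in>B. mdist Z a b < r + e"
proof -
  have "(SUP a\<in>A. INF b\<in>B. ereal (mdist Z a b)) \<le> ereal r"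
    using assms(1) by (simp add: hausdorff_dist_def)
  then have "(INF b\<in>B. ereal (mdist Z a b)) \<le> ereal r"
    using assms(2) by (simp add: SUP_le_iff)
  also have "ereal r < ereal (r + e)"
    using assms(3) by simp
  finally show ?thesis
    by (auto simp: INF_less_iff)
qed

lemma hausdorff_dist_leI:
  assumes "\<And>a. a \<in> A \<Longrightarrow> \<exists>b\<in>B. mdist Z a b \<le> r"
    and "\<And>b. b \<in> B \<Longrightarrow> \<exists>a\<in>A. mdist Z a b \<le> r"
  shows "hausdorff_dist Z A B \<le> ereal r"
  unfolding hausdorff_dist_def using assms
  by (intro max.boundedI SUP_least) (meson INF_lower2 ereal_less_eq(3))+

lemma mdist_le_space_diam:
  assumes "x \<in> mspace X" "y \<in> mspace X"
  shows "ereal (mdist X x y) \<le> space_diam X"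
  unfolding space_diam_def using assms by (meson SUP_upper SUP_upper2)

lemma space_diam_leI:
  assumes "\<And>x y. x \<in> mspace X \<Longrightarrow> y \<in> mspace X \<Longrightarrow> ereal (mdist X x y) \<le> c"
  shows "space_diam X \<le> c"
  unfolding space_diam_def by (intro SUP_least assms)

lemma space_diam_finite:
  assumes "mspace X \<noteq> {}" "Metric_space.mbounded (mspace X) (mdist X) (mspace X)"
  obtains D where "space_diam X = ereal D"
proof -
  obtain C where "\<And>x y. x \<in> mspace X \<Longrightarrow> y \<in> mspace X \<Longrightarrow> mdist X x y \<le> C"
    using assms(2) by (auto simp: Metric_space.mbounded_alt[OF Metric_space_mspace_mdist])
  then have le: "space_diam X \<le> ereal C"
    by (intro space_diam_leI) simp
  obtain x where "x \<in> mspace X" using assms(1) by blast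
  from mdist_le_space_diam[OF this this] have "0 \<le> space_diam X"
    by (metis \<open>x \<in> mspace X\<close> mdist_zero zero_ereal_def)
  with le show ?thesis
    by (cases "space_diam X") (auto intro: that)
qed

lemma simplex_mdist_eq:
  assumes "is_simplex l S" "s \<in> mspace S" "t \<in> mspace S"
  shows "mdist S s t = (if s = t then 0 else l)"
  using assms by (auto simp: is_simplex_def)

section \<open>The lower bound\<close>

lemma gh_realizable_simplex_lower_bound:
  fixes X :: "'a metric" and S :: "'b metric" and Z :: "'c metric"
  assumes l: "0 \<le> l" and S: "is_simplex l S" and card: "mspace X \<prec> mspace S"
    and real: "gh_realizable S X Z r"
  shows "l \<le> 2 * r"
    and "\<And>x y. x \<in> mspace X \<Longrightarrow> y \<in> mspace X \<Longrightarrow> mdist X x y \<le> l + 2 * r"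
proof -
  obtain A B f h where AB: "A \<subseteq> mspace Z" "B \<subseteq> mspace Z"
    and f: "bij_betw f A (mspace S)" "\<And>x y. x\<in>A \<Longrightarrow> y\<in>A \<Longrightarrow> mdist S (f x) (f y) = mdist Z x y"
    and h: "bij_betw h B (mspace X)" "\<And>x y. x\<in>B \<Longrightarrow> y\<in>B \<Longrightarrow> mdist X (h x) (h y) = mdist Z x y"
    and H: "hausdorff_dist Z A B \<le> ereal r"
    using real unfolding gh_realizable_def isometric_spaces_def
    by (auto simp: Int_absorb2 Int_absorb1)
  have dA: "mdist Z a a' = (if a = a' then 0 else l)" if "a \<in> A" "a' \<in> A" for a a'
    using that f simplex_mdist_eq[OF S] by (metis bij_betw_apply bij_betw_inv_into_left)
  \<comment> \<open>By cardinality, any choice of neighbours in \<open>B\<close> for the points of \<open>A\<close> must repeat a neighbour.\<close>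
  have noinj: "\<not> A \<lesssim> B"
  proof
    assume "A \<lesssim> B"
    moreover have "A \<approx> mspace S" "B \<approx> mspace X"
      using f(1) h(1) by (auto simp: eqpoll_def)
    ultimately have "mspace S \<lesssim> mspace X"
      by (meson eqpoll_imp_lepoll eqpoll_sym lepoll_trans)
    with card show False
      by (meson lepoll_antisym lesspoll_def)
  qed
  show "l \<le> 2 * r"
  proof (rule field_le_epsilon)
    fix e :: real assume e: "e > 0"
    have "\<forall>a\<in>A. \<exists>b\<in>B. mdist Z a b < r + e/2"
      using hausdorff_dist_leD[OF H] e by simp
    then obtain g where g: "\<And>a. a \<in> A \<Longrightarrow> g a \<in> B" "\<And>a. a \<in> A \<Longrightarrow> mdist Z a (g a) < r + e/2"
      by metis
    then have "\<not> inj_on g A"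
      using noinj by (auto simp: lepoll_def)
    then obtain a a' where a: "a \<in> A" "a' \<in> A" "a \<noteq> a'" "g a = g a'"
      by (auto simp: inj_on_def)
    have "l = mdist Z a a'"
      using dA a by simp
    also have "\<dots> \<le> mdist Z a (g a) + mdist Z (g a) a'"
      using AB a g by (intro mdist_triangle) auto
    also have "\<dots> \<le> 2 * r + e"
      using g(2)[OF a(1)] g(2)[OF a(2)] a(4) by (simp add: mdist_commute)
    finally show "l \<le> 2 * r + e" .
  qed
  show "mdist X x y \<le> l + 2 * r" if xy: "x \<in> mspace X" "y \<in> mspace X" for x y
  proof (rule field_le_epsilon)
    fix e :: real assume e: "e > 0"
    obtain u v where u: "u \<in> B" "h u = x" and v: "v \<in> B" "h v = y"
      using xy h(1) by (metis bij_betw_iff_bijections)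
    obtain a where a: "a \<in> A" "mdist Z u a < r + e/2"
      using hausdorff_dist_leD[OF H[unfolded hausdorff_dist_commute[of Z A B]] u(1), of "e/2"] e by auto
    obtain c where c: "c \<in> A" "mdist Z v c < r + e/2"
      using hausdorff_dist_leD[OF H[unfolded hausdorff_dist_commute[of Z A B]] v(1), of "e/2"] e by auto
    have m: "u \<in> mspace Z" "v \<in> mspace Z" "a \<in> mspace Z" "c \<in> mspace Z"
      using AB u v a c by auto
    have "mdist X x y = mdist Z u v"
      using h(2) u v by blast
    also have "\<dots> \<le> mdist Z u a + (mdist Z a c + mdist Z c v)"
      using mdist_triangle[of u Z a v] mdist_triangle[of a Z c v] m by linarith
    also have "\<dots> \<le> l + 2 * r + e"
      using a(2) c(2) dA[OF a(1) c(1)] l by (auto simp: mdist_commute split: if_splits)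
    finally show "mdist X x y \<le> l + 2 * r + e" .
  qed
qed

section \<open>The upper bound\<close>

text \<open>For \<open>f\<close> from a simplex \<open>S\<close> onto \<open>X\<close>, the shortest-path distance after joining each \<open>s\<close>
  to \<open>f s\<close> by a segment of length \<open>r\<close>. In the mixed case the path from \<open>s\<close> to \<open>x\<close> either goes
  through \<open>f s\<close>, or first jumps, at cost \<open>l\<close>, to a vertex of \<open>S\<close> that \<open>f\<close> sends to \<open>x\<close>.\<close>

fun glue_dist ::
  "'a metric \<Rightarrow> 'b metric \<Rightarrow> ('a \<Rightarrow> 'b) \<Rightarrow> real \<Rightarrow> real \<Rightarrow> 'a + 'b \<Rightarrow> 'a + 'b \<Rightarrow> real" where
  "glue_dist S X f l r (Inl s) (Inl t) = mdist S s t"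
| "glue_dist S X f l r (Inr x) (Inr y) = mdist X x y"
| "glue_dist S X f l r (Inl s) (Inr x) = r + min l (mdist X (f s) x)"
| "glue_dist S X f l r (Inr x) (Inl s) = r + min l (mdist X (f s) x)"

text \<open>The bounds on \<open>r\<close> keep detours through the other space from being shortcuts: a detour
  between two points of \<open>S\<close> costs at least \<open>2 * r\<close>, and one between two points \<open>x\<close>, \<open>y\<close> of
  \<open>X\<close> costs at least \<open>2 * r + mdist X x y\<close> or at least \<open>2 * r + l\<close>.\<close>

lemma Metric_space_glue_dist:
  assumes l: "0 < l" and S: "is_simplex l S"
    and f: "\<And>s. s \<in> mspace S \<Longrightarrow> f s \<in> mspace X"
    and r: "l \<le> 2 * r" and D: "\<And>x y. x \<in> mspace X \<Longrightarrow> y \<in> mspace X \<Longrightarrow> mdist X x y \<le> l + 2 * r"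
  shows "Metric_space (mspace S <+> mspace X) (glue_dist S X f l r)"
proof
  fix p q :: "'a + 'b"
  show "0 \<le> glue_dist S X f l r p q"
    using l r by (cases p; cases q) auto
  show "glue_dist S X f l r p q = glue_dist S X f l r q p"
    by (cases p; cases q) (auto simp: mdist_commute)
next
  fix p q :: "'a + 'b" assume pq: "p \<in> mspace S <+> mspace X" "q \<in> mspace S <+> mspace X"
  have pos: "r + min l (mdist X x y) > 0" for x y
    using l r mdist_nonneg[of X x y] by linarith
  show "glue_dist S X f l r p q = 0 \<longleftrightarrow> p = q"
    using pq pos by (cases p; cases q) (auto simp: less_le)
next
  fix p q w :: "'a + 'b"
  assume pqw: "p \<in> mspace S <+> mspace X" "q \<in> mspace S <+> mspace X" "w \<in> mspace S <+> mspace X"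
  have SSX: "min l (mdist X (f s) x) \<le> mdist S s t + min l (mdist X (f t) x)"
    if "s \<in> mspace S" "t \<in> mspace S" for s t x
  proof (cases "s = t")
    case False
    then have "mdist S s t = l"
      using simplex_mdist_eq[OF S that] by simp
    then show ?thesis
      using l mdist_nonneg[of X "f t" x] by linarith
  qed simp
  have SXX: "min l (mdist X (f s) y) \<le> min l (mdist X (f s) x) + mdist X x y"
    if "s \<in> mspace S" "x \<in> mspace X" "y \<in> mspace X" for s x y
    using mdist_triangle[OF f[OF that(1)] that(2,3)] mdist_nonneg[of X x y] by linarith
  have SXS: "mdist S s t \<le> 2 * r + min l (mdist X (f s) x) + min l (mdist X (f t) x)"
    if "s \<in> mspace S" "t \<in> mspace S" for s t x
  proof -
    have "mdist S s t \<le> l"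
      using simplex_mdist_eq[OF S that] l by simp
    then show ?thesis
      using l r mdist_nonneg[of X "f s" x] mdist_nonneg[of X "f t" x] by linarith
  qed
  have XSX: "mdist X x y \<le> 2 * r + min l (mdist X (f s) x) + min l (mdist X (f s) y)"
    if "s \<in> mspace S" "x \<in> mspace X" "y \<in> mspace X" for s x y
    using mdist_triangle[OF that(2) f[OF that(1)] that(3)] D[OF that(2,3)] l r
      mdist_nonneg[of X "f s" x] mdist_nonneg[of X "f s" y] mdist_commute[of X x "f s"]
    by linarith
  show "glue_dist S X f l r p w \<le> glue_dist S X f l r p q + glue_dist S X f l r q w"
  proof (cases p; cases q; cases w)
    fix s t u assume *: "p = Inl s" "q = Inl t" "w = Inl u"
    then show ?thesis using pqw by (auto intro: mdist_triangle)
  next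
    fix s t x assume *: "p = Inl s" "q = Inl t" "w = Inr x"
    then show ?thesis using pqw SSX[of s t x] by auto
  next
    fix s x t assume *: "p = Inl s" "q = Inr x" "w = Inl t"
    then show ?thesis using pqw SXS[of s t x] by auto
  next
    fix s x y assume *: "p = Inl s" "q = Inr x" "w = Inr y"
    then show ?thesis using pqw SXX[of s x y] by auto
  next
    fix x s t assume *: "p = Inr x" "q = Inl s" "w = Inl t"
    then show ?thesis using pqw SSX[of t s x] by (auto simp: mdist_commute)
  next
    fix x s y assume *: "p = Inr x" "q = Inl s" "w = Inr y"
    then show ?thesis using pqw XSX[of s x y] by auto
  next
    fix x y s assume *: "p = Inr x" "q = Inr y" "w = Inl s"
    then show ?thesis using pqw SXX[of s y x] by (auto simp: mdist_commute)
  next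
    fix x y z assume *: "p = Inr x" "q = Inr y" "w = Inr z"
    then show ?thesis using pqw by (auto intro: mdist_triangle)
  qed
qed

lemma gh_realizable_simplex:
  fixes X :: "'a metric" and S :: "'b metric"
  assumes l: "0 < l" and S: "is_simplex l S" and ne: "mspace X \<noteq> {}"
    and card: "mspace X \<lesssim> mspace S"
    and r: "l \<le> 2 * r" and D: "\<And>x y. x \<in> mspace X \<Longrightarrow> y \<in> mspace X \<Longrightarrow> mdist X x y \<le> l + 2 * r"
  shows "\<exists>Z :: ('b + 'a) metric. gh_realizable S X Z r"
proof -
  obtain g where g: "inj_on g (mspace X)" "g ` mspace X \<subseteq> mspace S"
    using card by (auto simp: lepoll_def)
  obtain x0 where x0: "x0 \<in> mspace X" using ne by blast
  \<comment> \<open>A left inverse of \<open>g\<close>, extended by \<open>x0\<close> to all of \<open>S\<close>, maps \<open>S\<close> onto \<open>X\<close>.\<close>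
  define f where "f s = (if s \<in> g ` mspace X then inv_into (mspace X) g s else x0)" for s
  have f: "f s \<in> mspace X" for s
    using x0 by (auto simp: f_def inv_into_into)
  have fg: "f (g x) = x" if "x \<in> mspace X" for x
    using that g by (simp add: f_def)
  define d where "d = glue_dist S X f l r"
  define Z where "Z = metric (mspace S <+> mspace X, d)"
  interpret Z: Metric_space "mspace S <+> mspace X" d
    unfolding d_def using l S f r D by (rule Metric_space_glue_dist)
  have Z: "mspace Z = mspace S <+> mspace X" "mdist Z = d"
    by (simp_all add: Z_def)
  have isoS: "isometric_spaces (submetric Z (Inl ` mspace S)) S"
  proof -
    have "mspace (submetric Z (Inl ` mspace S)) = Inl ` mspace S"
      by (auto simp: Z)
    then show ?thesis
      unfolding isometric_spaces_def
      by (intro exI[of _ projl]) (auto simp: Z d_def intro!: bij_betw_byWitness[where f' = Inl])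
  qed
  have isoX: "isometric_spaces (submetric Z (Inr ` mspace X)) X"
  proof -
    have "mspace (submetric Z (Inr ` mspace X)) = Inr ` mspace X"
      by (auto simp: Z)
    then show ?thesis
      unfolding isometric_spaces_def
      by (intro exI[of _ projr]) (auto simp: Z d_def intro!: bij_betw_byWitness[where f' = Inr])
  qed
  have near: "mdist Z (Inl s) (Inr (f s)) \<le> r" for s
    using l mdist_zero[OF f[of s] f[of s]] by (simp add: Z d_def)
  have "hausdorff_dist Z (Inl ` mspace S) (Inr ` mspace X) \<le> ereal r"
  proof (rule hausdorff_dist_leI)
    fix a :: "'b + 'a" assume "a \<in> Inl ` mspace S"
    then show "\<exists>b\<in>Inr ` mspace X. mdist Z a b \<le> r"
      using near f by auto
  next
    fix b :: "'b + 'a" assume "b \<in> Inr ` mspace X"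
    then obtain x where x: "x \<in> mspace X" "b = Inr x" by auto
    then have "mdist Z (Inl (g x)) b \<le> r"
      using near[of "g x"] fg by simp
    then show "\<exists>a\<in>Inl ` mspace S. mdist Z a b \<le> r"
      using x g by blast
  qed
  with isoS isoX show ?thesis
    unfolding gh_realizable_def
    by (intro exI[of _ Z] exI[of _ "Inl ` mspace S"] exI[of _ "Inr ` mspace X"]) (auto simp: Z)
qed

section \<open>The distance to a larger simplex\<close>

theorem theorem2p1:
  fixes X :: "'a metric" and S :: "'b metric" and l :: real
  assumes "mspace X \<noteq> {}"
    and "Metric_space.mbounded (mspace X) (mdist X) (mspace X)"
    and "0 < l"
    and "is_simplex l S"
    and "mspace X \<prec> mspace S"
  shows "2 * gh_dist S X = max (ereal l) (space_diam X - ereal l)"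
proof -
  obtain D where D: "space_diam X = ereal D"
    by (rule space_diam_finite[OF assms(1,2)])
  define r where "r = max l (D - l) / 2"
  have "mdist X x y \<le> D" if "x \<in> mspace X" "y \<in> mspace X" for x y
    using mdist_le_space_diam[OF that] D by simp
  then have "mdist X x y \<le> l + 2 * r" if "x \<in> mspace X" "y \<in> mspace X" for x y
    using that by (fastforce simp: r_def max_def)
  then have "\<exists>Z :: ('b + 'a) metric. gh_realizable S X Z r"
    using assms by (intro gh_realizable_simplex) (auto simp: r_def lesspoll_def)
  then have upper: "gh_dist S X \<le> ereal r"
    using gh_dist_le by blast
  have "r \<le> t" if "gh_realizable S X Z t" for Z :: "('b + 'a) metric" and t
  proof -
    note lb = gh_realizable_simplex_lower_bound[OF less_imp_le[OF assms(3)] assms(4,5) that]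
    have "space_diam X \<le> ereal (l + 2 * t)"
      using lb(2) by (intro space_diam_leI) simp
    with lb(1) show ?thesis
      by (simp add: D r_def)
  qed
  then have lower: "ereal r \<le> gh_dist S X"
    unfolding gh_dist_def by (intro Inf_greatest) auto
  have "gh_dist S X = ereal r"
    using upper lower by (rule antisym)
  then have "2 * gh_dist S X = ereal (2 * r)"
    by simp
  also have "\<dots> = ereal (max l (D - l))"
    by (simp add: r_def)
  also have "\<dots> = max (ereal l) (space_diam X - ereal l)"
    by (simp only: D ereal_minus(1) ereal_max)
  finally show ?thesis .
qed

end
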